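(* For any finite field $\mathbf{k}$, there is a graph $G$ such that $s_{\mathbf{k}}\chi(G)<\chi(G)$.
   Context: Graphs are simple and undirected, and $\chi(G)$ is the usual chromatic number. For a field $\mathbf{k}$ and $n\ge 0$, let $P\mathbf{k}^n$ be the set of $1$-dimensional subspaces of $\mathbf{k}^n$ and $\mathrm{Gr}_{n-1}(\mathbf{k}^n)$ the set of $(n-1)$-dimensional subspaces. An $n$-span colouring of $G$ over $\mathbf{k}$ is a function assigning to each vertex $x$ a pair $(U_x,V_x)\in P\mathbf{k}^n\times \mathrm{Gr}_{n-1}(\mathbf{k}^n)$ such that $U_x\not\subset V_x$ for every vertex $x$, and $U_x\subset V_y$ and $U_y\subset V_x$ for every edge $(x,y)$. The span chromatic number $s_{\mathbf{k}}\chi(G)$ is the least $n$ such that $G$ has an $n$-span colouring over $\mathbf{k}$. *)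

theory Defs
  imports
    "Jordan_Normal_Form.VS_Connect"
    "Graph_Theory.Pair_Digraph"
    "HOL-Library.Extended_Nat"
begin

definition proper_colouring :: "'v pair_pre_digraph \<Rightarrow> nat \<Rightarrow> ('v \<Rightarrow> nat) \<Rightarrow> bool" where
  "proper_colouring G n c \<longleftrightarrow>
     (\<forall>x\<in>pverts G. c x < n) \<and> (\<forall>(x, y)\<in>parcs G. c x \<noteq> c y)"

text \<open>Both chromatic numbers below take the value \<open>\<infinity>\<close> when no colouring exists
  (the infimum of the empty set in \<^typ>\<open>enat\<close>).\<close>

definition chromatic_number :: "'v pair_pre_digraph \<Rightarrow> enat" where
  "chromatic_number G = (INF n \<in> {n. \<exists>c. proper_colouring G n c}. enat n)"

definition grassmannian :: "nat \<Rightarrow> nat \<Rightarrow> 'k::field vec set set" where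
  "grassmannian d n =
     {W. VectorSpace.subspace class_ring W (module_vec TYPE('k) n) \<and>
         vectorspace.dim class_ring (module_vec TYPE('k) n\<lparr>carrier := W\<rparr>) = d}"

text \<open>The subspaces of dimension \<open>n - 1\<close>; writing \<open>d + 1 = n\<close> avoids truncated subtraction, so
  that there are none for \<open>n = 0\<close>.\<close>

definition hyperplanes :: "nat \<Rightarrow> 'k::field vec set set" where
  "hyperplanes n = {W. \<exists>d. d + 1 = n \<and> W \<in> grassmannian d n}"

definition span_colouring ::
  "'v pair_pre_digraph \<Rightarrow> nat \<Rightarrow> ('v \<Rightarrow> 'k::field vec set \<times> 'k vec set) \<Rightarrow> bool" where
  "span_colouring G n f \<longleftrightarrow>
     (\<forall>x\<in>pverts G. f x \<in> grassmannian 1 n \<times> hyperplanes n \<and> \<not> fst (f x) \<subseteq> snd (f x)) \<and>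
     (\<forall>(x, y)\<in>parcs G. fst (f x) \<subseteq> snd (f y) \<and> fst (f y) \<subseteq> snd (f x))"

definition span_chromatic_number :: "'k::field itself \<Rightarrow> 'v pair_pre_digraph \<Rightarrow> enat" where
  "span_chromatic_number K G =
     (INF n \<in> {n. \<exists>f :: 'v \<Rightarrow> 'k vec set \<times> 'k vec set. span_colouring G n f}. enat n)"

end

theory Submission
  imports
    Defs
    "HOL-Number_Theory.Residues"
    "Berlekamp_Zassenhaus.Berlekamp_Type_Based"
begin

text \<open>Let \<open>q = |k|\<close> and let \<open>n > q\<close> be prime. The rank-one idempotents of \<open>k\<^sup>n\<close> (presented as
  pairs of a vector and a covector), joined when they annihilate each other, form a graph with a tautological
  \<open>n\<close>-span colouring. It is vertex transitive under the general linear group and the standard basis is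
  an \<open>n\<close>-clique, so an \<open>n\<close>-colouring would split the vertices into \<open>n\<close> classes of equal size. But the
  number of vertices is \<open>(q\<^sup>n - 1) q\<^sup>n\<^sup>-\<^sup>1\<close>, which is prime to \<open>n\<close> because \<open>q\<^sup>n - 1\<close> is congruent to
  \<open>q - 1\<close> modulo \<open>n\<close> and \<open>0 < q - 1 < q < n\<close>.\<close>

section \<open>Cliques and colour classes in vertex-transitive graphs\<close>

definition automorphism :: "'v pair_pre_digraph \<Rightarrow> ('v \<Rightarrow> 'v) \<Rightarrow> bool" where
  "automorphism G h \<longleftrightarrow> bij_betw h (pverts G) (pverts G) \<and>
     (\<forall>x\<in>pverts G. \<forall>y\<in>pverts G. (h x, h y) \<in> parcs G \<longleftrightarrow> (x, y) \<in> parcs G)"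

definition vertex_transitive :: "'v pair_pre_digraph \<Rightarrow> bool" where
  "vertex_transitive G \<longleftrightarrow>
     (\<forall>x\<in>pverts G. \<forall>y\<in>pverts G. \<exists>h. automorphism G h \<and> h x = y)"

definition clique :: "'v pair_pre_digraph \<Rightarrow> 'v set \<Rightarrow> bool" where
  "clique G K \<longleftrightarrow> K \<subseteq> pverts G \<and> (\<forall>x\<in>K. \<forall>y\<in>K. x \<noteq> y \<longrightarrow> (x, y) \<in> parcs G)"

lemma clique_image:
  assumes "automorphism G h" "clique G K"
  shows "clique G (h ` K)" "card (h ` K) = card K"
proof -
  have inj: "inj_on h (pverts G)" and im: "h ` pverts G = pverts G"
    using assms(1) by (auto simp: automorphism_def bij_betw_def)
  have K: "K \<subseteq> pverts G"
    using assms(2) by (simp add: clique_def)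
  show "card (h ` K) = card K"
    using inj K by (meson card_image inj_on_subset)
  have "h ` K \<subseteq> pverts G"
    using im K by blast
  moreover have "(h x, h y) \<in> parcs G" if "x \<in> K" "y \<in> K" "h x \<noteq> h y" for x y
    using that assms K unfolding automorphism_def clique_def by (metis subsetD)
  ultimately show "clique G (h ` K)"
    by (auto simp: clique_def)
qed

text \<open>Taking images under \<open>h\<close> is injective on sets of vertices and preserves
  cliques and their size. An inequality suffices, since transitivity supplies automorphisms in both
  directions between two vertices.\<close>

lemma card_cliques_through_le:
  assumes "finite (pverts G)" "automorphism G h"
  shows "card {K. clique G K \<and> card K = n \<and> x \<in> K} \<le> card {K. clique G K \<and> card K = n \<and> h x \<in> K}"
proof (rule card_inj_on_le)
  have inj: "inj_on h (pverts G)"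
    using assms(2) by (auto simp: automorphism_def bij_betw_def)
  show "inj_on ((`) h) {K. clique G K \<and> card K = n \<and> x \<in> K}"
    using inj_on_image_Pow[OF inj] by (rule inj_on_subset) (auto simp: clique_def)
  show "(`) h ` {K. clique G K \<and> card K = n \<and> x \<in> K} \<subseteq> {K. clique G K \<and> card K = n \<and> h x \<in> K}"
    using clique_image[OF assms(2)] by auto
  show "finite {K. clique G K \<and> card K = n \<and> h x \<in> K}"
    by (rule finite_subset[of _ "Pow (pverts G)"]) (use assms(1) in \<open>auto simp: clique_def\<close>)
qed

text \<open>In an \<open>n\<close>-colouring each \<open>n\<close>-clique meets a colour class exactly once, and by transitivity
  each vertex lies in the same number of \<open>n\<close>-cliques, so all colour classes have the same size.\<close>

lemma vertex_transitive_colouring_dvd: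
  assumes fin: "finite (pverts G)" and trans: "vertex_transitive G"
    and K0: "clique G K0" "card K0 = n" and "0 < n" and col: "proper_colouring G n c"
  shows "n dvd card (pverts G)"
proof -
  define \<K> where "\<K> = {K. clique G K \<and> card K = n}"
  \<comment> \<open>A single colour class is enough: \<open>n\<close> times its size will turn out
    to be the number of vertices.\<close>
  define C where "C = {x\<in>pverts G. c x = 0}"
  have fin\<K>: "finite \<K>"
    by (rule finite_subset[of _ "Pow (pverts G)"]) (use fin in \<open>auto simp: clique_def \<K>_def\<close>)
  obtain x0 where x0: "x0 \<in> K0"
    using K0 \<open>0 < n\<close> by fastforce
  then have x0V: "x0 \<in> pverts G"
    using K0 by (auto simp: clique_def)
  define N where "N = card {K\<in>\<K>. x0 \<in> K}"
  have "K0 \<in> {K\<in>\<K>. x0 \<in> K}"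
    using x0 K0 by (simp add: \<K>_def)
  with fin\<K> have "N > 0"
    unfolding N_def card_gt_0_iff by auto
  have "card {K\<in>\<K>. x \<in> K} \<le> card {K\<in>\<K>. y \<in> K}" if xy: "x \<in> pverts G" "y \<in> pverts G" for x y
  proof -
    obtain h where "automorphism G h" "h x = y"
      using trans xy unfolding vertex_transitive_def by blast
    with card_cliques_through_le[OF fin, of h n x] show ?thesis
      by (simp add: \<K>_def conj_assoc)
  qed
  then have N: "card {K\<in>\<K>. x \<in> K} = N" if "x \<in> pverts G" for x
    using that x0V unfolding N_def by (intro antisym) auto
  \<comment> \<open>Double counting of incidences between vertices and \<open>n\<close>-cliques,
    first over all vertices and then over the colour class \<open>C\<close>.\<close>
  have "(\<Sum>K\<in>\<K>. card {x\<in>pverts G. x \<in> K}) = N * card (pverts G)"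
    by (rule sum_multicount) (use fin fin\<K> N in auto)
  moreover have "card {x\<in>pverts G. x \<in> K} = n" if "K \<in> \<K>" for K
  proof -
    have "{x\<in>pverts G. x \<in> K} = K"
      using that by (auto simp: \<K>_def clique_def)
    then show ?thesis
      using that by (simp add: \<K>_def)
  qed
  ultimately have eqV: "card \<K> * n = N * card (pverts G)"
    by simp
  have "(\<Sum>K\<in>\<K>. card {x\<in>C. x \<in> K}) = N * card C"
    by (rule sum_multicount) (use fin fin\<K> N in \<open>auto simp: C_def\<close>)
  moreover have "card {x\<in>C. x \<in> K} = 1" if "K \<in> \<K>" for K
  proof -
    have K: "K \<subseteq> pverts G" "card K = n"
      and edge: "\<And>x y. \<lbrakk>x \<in> K; y \<in> K; x \<noteq> y\<rbrakk> \<Longrightarrow> (x, y) \<in> parcs G"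
      using that by (auto simp: \<K>_def clique_def)
    have inj: "inj_on c K"
      using edge col by (fastforce simp: inj_on_def proper_colouring_def)
    \<comment> \<open>The \<open>n\<close> vertices of a clique have distinct colours below
      \<open>n\<close>, so every colour occurs, in particular 0.\<close>
    have "c ` K = {..<n}"
    proof (rule card_subset_eq)
      show "c ` K \<subseteq> {..<n}"
        using col K by (auto simp: proper_colouring_def)
      show "card (c ` K) = card {..<n}"
        using inj K by (simp add: card_image)
    qed simp
    then obtain x where x: "x \<in> K" "c x = 0"
      using \<open>0 < n\<close> by (metis imageE lessThan_iff)
    have "{x\<in>C. x \<in> K} = {x}"
      using x K by (auto simp: C_def intro: inj_onD[OF inj])
    then show ?thesis
      by simp
  qed
  ultimately have "card \<K> = N * card C"
    by simp
  with eqV have "N * (card C * n) = N * card (pverts G)"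
    by (simp add: mult.assoc)
  with \<open>N > 0\<close> have "card (pverts G) = card C * n"
    by simp
  then show ?thesis
    by simp
qed

section \<open>Counting vectors and subspaces over a finite field\<close>

lemma (in vectorspace) finite_carrier_imp_fin_dim:
  assumes "finite (carrier V)"
  shows fin_dim
proof -
  have "span (carrier V) = carrier V"
    using span_is_subset2[of "carrier V"] span_mem[of "carrier V"] by auto
  then show ?thesis
    unfolding fin_dim_def using assms by auto
qed

text \<open>Coordinates with respect to a finite basis \<open>B\<close> identify the space with the
  functions from \<open>B\<close> to the scalars.\<close>

lemma (in vectorspace) card_carrier_eq_power_dim:
  assumes "finite (carrier V)"
  shows "card (carrier V) = card (carrier K) ^ dim"
proof -
  obtain B where B: "finite B" "basis B"
    using finite_basis_exists[OF finite_carrier_imp_fin_dim[OF assms]] by blast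
  then have BV: "B \<subseteq> carrier V"
    by (simp add: basis_def)
  have "bij_betw (\<lambda>a. lincomb a B) (B \<rightarrow>\<^sub>E carrier K) (carrier V)"
  proof -
    have ex1: "\<exists>!a. a \<in> B \<rightarrow>\<^sub>E carrier K \<and> lincomb a B = v" if "v \<in> carrier V" for v
      using basis_criterion[OF B(1) BV] B(2) that by blast
    have closed: "lincomb a B \<in> carrier V" if "a \<in> B \<rightarrow>\<^sub>E carrier K" for a
      using that BV by (intro lincomb_closed) auto
    show ?thesis
      unfolding bij_betw_def inj_on_def using ex1 closed by (auto simp: image_iff) (metis+)
  qed
  then have "card (carrier V) = card (B \<rightarrow>\<^sub>E carrier K)"
    by (metis bij_betw_same_card)
  then show ?thesis
    using B by (simp add: card_PiE dim_basis basis_def)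
qed

text \<open>Over a finite field the cardinality of a subspace determines its dimension, because
  powers of \<open>CARD('k) > 1\<close> have unique exponents. Counting thus replaces the
  construction of a basis.\<close>

lemma grassmannianI:
  fixes W :: "'k::{field,finite} vec set"
  assumes sub: "W \<subseteq> carrier_vec n" and zero: "0\<^sub>v n \<in> W"
    and add: "\<And>v w. \<lbrakk>v \<in> W; w \<in> W\<rbrakk> \<Longrightarrow> v + w \<in> W"
    and smult: "\<And>a v. v \<in> W \<Longrightarrow> a \<cdot>\<^sub>v v \<in> W"
    and card: "card W = CARD('k) ^ d"
  shows "W \<in> grassmannian d n"
proof -
  interpret V: vec_space "TYPE('k)" n .
  have subspace: "VectorSpace.subspace class_ring W (module_vec TYPE('k) n)"
    using sub zero add smult V.module_axioms V.vectorspace_axioms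
    by (auto simp: VectorSpace.subspace_def submodule_def module_vec_simps class_ring_simps)
  interpret W: vectorspace class_ring "module_vec TYPE('k) n\<lparr>carrier := W\<rparr>"
    by (rule V.subspace_is_vs[OF subspace])
  have "finite W"
    using sub finite_carrier_vec finite_subset by blast
  then have "CARD('k) ^ d = CARD('k) ^ W.dim"
    using W.card_carrier_eq_power_dim card by (simp add: class_ring_simps)
  moreover have "CARD('k) > 1"
    using card_mono[of "UNIV :: 'k set" "{0, 1}"] by simp
  ultimately have "W.dim = d"
    by (metis power_inject_exp)
  with subspace show ?thesis
    by (simp add: grassmannian_def)
qed

lemma ex_scalar_prod_eq_1:
  fixes u :: "'k::field vec"
  assumes "u \<in> carrier_vec n" "u \<noteq> 0\<^sub>v n"
  shows "\<exists>w\<in>carrier_vec n. u \<bullet> w = 1"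
proof -
  obtain i where i: "i < n" "u $ i \<noteq> 0"
    using assms by (metis carrier_vecD eq_vecI index_zero_vec)
  then have "u \<bullet> (inverse (u $ i) \<cdot>\<^sub>v unit_vec n i) = 1"
    using assms by simp
  then show ?thesis
    by (metis smult_carrier_vec unit_vec_carrier)
qed

text \<open>The \<open>CARD('k)\<close> level sets of a nonzero functional are translates of each other.\<close>

lemma card_scalar_prod_level:
  fixes u :: "'k::{field,finite} vec"
  assumes u: "u \<in> carrier_vec n" "u \<noteq> 0\<^sub>v n"
  shows "CARD('k) * card {w\<in>carrier_vec n. u \<bullet> w = a} = CARD('k) ^ n"
proof -
  let ?L = "\<lambda>a. {w\<in>carrier_vec n. u \<bullet> w = a}"
  obtain w0 where w0: "w0 \<in> carrier_vec n" "u \<bullet> w0 = 1"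
    using ex_scalar_prod_eq_1[OF u] by blast
  have eq: "card (?L b) = card (?L a)" for b
  proof (rule bij_betw_same_card[of "\<lambda>w. w + (a - b) \<cdot>\<^sub>v w0"],
      rule bij_betw_byWitness[where f' = "\<lambda>w. w + (b - a) \<cdot>\<^sub>v w0"])
    have *: "w + (x - y) \<cdot>\<^sub>v w0 + (y - x) \<cdot>\<^sub>v w0 = w" if "w \<in> carrier_vec n" for w x y
      using that w0 by (intro eq_vecI) (auto simp: algebra_simps)
    show "\<forall>w\<in>?L b. w + (a - b) \<cdot>\<^sub>v w0 + (b - a) \<cdot>\<^sub>v w0 = w"
      and "\<forall>w\<in>?L a. w + (b - a) \<cdot>\<^sub>v w0 + (a - b) \<cdot>\<^sub>v w0 = w"
      using * by auto
  qed (use u w0 in \<open>auto simp: scalar_prod_add_distrib[of _ n]\<close>)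
  have "carrier_vec n = (\<Union>b. ?L b)"
    by auto
  then have "CARD('k) ^ n = card (\<Union>b. ?L b)"
    by (metis card_carrier_vec)
  also have "\<dots> = (\<Sum>b\<in>UNIV. card (?L b))"
    by (rule card_UN_disjoint) auto
  also have "\<dots> = (\<Sum>b\<in>(UNIV :: 'k set). card (?L a))"
    by (rule sum.cong[OF refl eq])
  finally show ?thesis
    by simp
qed

section \<open>The graph of rank-one idempotents\<close>

text \<open>A pair \<open>(u, w)\<close> stands for the rank-one idempotent \<open>v \<mapsto> (w \<bullet> v) u\<close>; adjacent idempotents
  annihilate each other.\<close>

definition idempotent_graph :: "nat \<Rightarrow> ('k::field vec \<times> 'k vec) pair_pre_digraph" where
  "idempotent_graph n =
     (let V = {(u, w). u \<in> carrier_vec n \<and> w \<in> carrier_vec n \<and> w \<bullet> u = 1}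
      in \<lparr>pverts = V, parcs = {((u, w), (u', w')).
            (u, w) \<in> V \<and> (u', w') \<in> V \<and> w \<bullet> u' = 0 \<and> w' \<bullet> u = 0}\<rparr>)"

lemma pverts_idempotent_graph [simp]:
  "(u, w) \<in> pverts (idempotent_graph n) \<longleftrightarrow>
     u \<in> carrier_vec n \<and> w \<in> carrier_vec n \<and> w \<bullet> u = 1"
  by (simp add: idempotent_graph_def Let_def)

lemma parcs_idempotent_graph [simp]:
  "((u, w), (u', w')) \<in> parcs (idempotent_graph n) \<longleftrightarrow>
     (u, w) \<in> pverts (idempotent_graph n) \<and> (u', w') \<in> pverts (idempotent_graph n) \<and>
     w \<bullet> u' = 0 \<and> w' \<bullet> u = 0"
  by (auto simp: idempotent_graph_def Let_def)

lemma finite_pverts_idempotent_graph: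
  "finite (pverts (idempotent_graph n :: ('k::{field,finite} vec \<times> 'k vec) pair_pre_digraph))"
proof (rule finite_subset)
  show "pverts (idempotent_graph n) \<subseteq> carrier_vec n \<times> (carrier_vec n :: 'k vec set)"
    by auto
qed simp

lemma pair_graph_idempotent_graph:
  "pair_graph (idempotent_graph n :: ('k::{field,finite} vec \<times> 'k vec) pair_pre_digraph)"
    (is "pair_graph ?G")
proof
  show "finite (pverts ?G)"
    by (rule finite_pverts_idempotent_graph)
  have sub: "parcs ?G \<subseteq> pverts ?G \<times> pverts ?G"
    by auto
  then show "finite (parcs ?G)"
    using finite_pverts_idempotent_graph by (meson finite_SigmaI finite_subset)
  show "fst e \<in> pverts ?G" "snd e \<in> pverts ?G" if "e \<in> parcs ?G" for e
    using sub that by auto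
  show "fst e \<noteq> snd e" if "e \<in> parcs ?G" for e
    using that by (cases e) auto
  show "symmetric ?G"
    by (auto simp: symmetric_def sym_def)
qed

text \<open>For each nonzero \<open>u\<close> the admissible \<open>w\<close> form a level set of a
  nonzero functional. The factor \<open>CARD('k)\<close> on the left avoids the exponent
  \<open>n - 1\<close>.\<close>

lemma card_pverts_idempotent_graph:
  "CARD('k) * card (pverts (idempotent_graph n :: ('k::{field,finite} vec \<times> 'k vec) pair_pre_digraph))
     = (CARD('k) ^ n - 1) * CARD('k) ^ n" (is "_ * card (pverts ?G) = _")
proof -
  let ?L = "\<lambda>u :: 'k vec. {w\<in>carrier_vec n. u \<bullet> w = 1}"
  have "pverts ?G = Sigma (carrier_vec n - {0\<^sub>v n}) ?L"
    by (auto simp: comm_scalar_prod[of _ n])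
  then have "card (pverts ?G) = (\<Sum>u\<in>carrier_vec n - {0\<^sub>v n}. card (?L u))"
    by simp
  then have "CARD('k) * card (pverts ?G) =
      (\<Sum>u\<in>carrier_vec n - {0\<^sub>v n}. CARD('k) * card (?L u))"
    by (simp add: sum_distrib_left)
  also have "\<dots> = (\<Sum>u\<in>carrier_vec n - {0\<^sub>v n :: 'k vec}. CARD('k) ^ n)"
    by (rule sum.cong) (simp_all add: card_scalar_prod_level)
  also have "\<dots> = (CARD('k) ^ n - 1) * CARD('k) ^ n"
    by (simp add: card_Diff_singleton card_carrier_vec)
  finally show ?thesis .
qed

section \<open>The standard clique and the action of the general linear group\<close>

lemma clique_unit_vecs:
  "clique (idempotent_graph n) ((\<lambda>i. (unit_vec n i, unit_vec n i)) ` {..<n})"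
  by (auto simp: clique_def)

lemma card_unit_vec_pairs:
  "card ((\<lambda>i. (unit_vec n i :: 'k::field vec, unit_vec n i :: 'k vec)) ` {..<n}) = n"
proof -
  have "inj_on (\<lambda>i. (unit_vec n i :: 'k vec, unit_vec n i :: 'k vec)) {..<n}"
    by (rule inj_onI) (metis lessThan_iff prod.inject unit_vec_eq)
  then show ?thesis
    by (metis card_image card_lessThan)
qed

text \<open>This is conjugation of idempotents by \<open>A\<close>: vectors move by \<open>A\<close>
  and covectors by the transposed inverse, so the pairing of covectors with vectors, and hence
  adjacency, is preserved.\<close>

lemma automorphism_idempotent_graph:
  fixes A B :: "'k::field mat"
  assumes A: "A \<in> carrier_mat n n" and B: "B \<in> carrier_mat n n" and BA: "B * A = 1\<^sub>m n"
  shows "automorphism (idempotent_graph n) (\<lambda>(u, w). (A *\<^sub>v u, B\<^sup>T *\<^sub>v w))"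
proof -
  let ?V = "pverts (idempotent_graph n :: ('k vec \<times> 'k vec) pair_pre_digraph)"
  have AB: "A * B = 1\<^sub>m n"
    using mat_mult_left_right_inverse[OF B A BA] .
  have T: "A\<^sup>T * B\<^sup>T = 1\<^sub>m n" "B\<^sup>T * A\<^sup>T = 1\<^sub>m n"
    by (simp_all add: AB BA flip: transpose_mult[OF A B] transpose_mult[OF B A])
  have prod: "(B\<^sup>T *\<^sub>v w) \<bullet> (A *\<^sub>v u) = w \<bullet> u" if "u \<in> carrier_vec n" "w \<in> carrier_vec n" for u w
  proof -
    have "(B\<^sup>T *\<^sub>v w) \<bullet> (A *\<^sub>v u) = w \<bullet> (B *\<^sub>v (A *\<^sub>v u))"
      using A B that by (intro transpose_vec_mult_scalar) auto
    then show ?thesis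
      using A B BA that by (metis assoc_mult_mat_vec one_mult_mat_vec)
  qed
  have prod': "(A\<^sup>T *\<^sub>v w) \<bullet> (B *\<^sub>v u) = w \<bullet> u" if "u \<in> carrier_vec n" "w \<in> carrier_vec n" for u w
  proof -
    have "(A\<^sup>T *\<^sub>v w) \<bullet> (B *\<^sub>v u) = w \<bullet> (A *\<^sub>v (B *\<^sub>v u))"
      using A B that by (intro transpose_vec_mult_scalar) auto
    then show ?thesis
      using A B AB that by (metis assoc_mult_mat_vec one_mult_mat_vec)
  qed
  have inv: "B *\<^sub>v (A *\<^sub>v v) = v" "A *\<^sub>v (B *\<^sub>v v) = v"
    "A\<^sup>T *\<^sub>v (B\<^sup>T *\<^sub>v v) = v" "B\<^sup>T *\<^sub>v (A\<^sup>T *\<^sub>v v) = v" if "v \<in> carrier_vec n" for v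
    using A B AB BA T that
    by (metis assoc_mult_mat_vec one_mult_mat_vec transpose_carrier_mat)+
  have "bij_betw (\<lambda>(u, w). (A *\<^sub>v u, B\<^sup>T *\<^sub>v w)) ?V ?V"
    by (rule bij_betw_byWitness[where f' = "\<lambda>(u, w). (B *\<^sub>v u, A\<^sup>T *\<^sub>v w)"])
      (use A B in \<open>auto simp: inv prod prod'\<close>)
  then show ?thesis
    using A B by (auto simp: automorphism_def prod)
qed

text \<open>Completes \<open>u\<close> and \<open>w\<close> to dual bases, given a coordinate \<open>j\<close> with \<open>w $ j \<noteq> 0\<close>: the vectors
  \<open>e\<^sub>k - (w\<^sub>k / w\<^sub>j) e\<^sub>j\<close> for \<open>k \<noteq> j\<close> span the kernel of \<open>w\<close>, and \<open>e\<^sub>k - u\<^sub>k w\<close> are dual to them.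
  The transposition puts \<open>u\<close> and \<open>w\<close> in first place.\<close>

lemma ex_dual_bases:
  fixes u w :: "'k::field vec"
  assumes u: "u \<in> carrier_vec n" and w: "w \<in> carrier_vec n" and wu: "w \<bullet> u = 1"
  shows "\<exists>A B. A \<in> carrier_mat n n \<and> B \<in> carrier_mat n n \<and> B * A = 1\<^sub>m n \<and>
    A *\<^sub>v unit_vec n 0 = u \<and> B\<^sup>T *\<^sub>v unit_vec n 0 = w"
proof -
  have "w \<noteq> 0\<^sub>v n"
    using wu u by auto
  then obtain j where j: "j < n" "w $ j \<noteq> 0"
    using w by (metis carrier_vecD eq_vecI index_zero_vec)
  define a where "a k = (if k = j then u else unit_vec n k - (w $ k / w $ j) \<cdot>\<^sub>v unit_vec n j)" for k
  define b where "b k = (if k = j then w else unit_vec n k - u $ k \<cdot>\<^sub>v w)" for k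
  have a: "a k \<in> carrier_vec n" and b: "b k \<in> carrier_vec n" for k
    using u w by (auto simp: a_def b_def)
  have wa: "w \<bullet> a l = (if l = j then 1 else 0)" if "l < n" for l
    using that u w wu j by (auto simp: a_def scalar_prod_minus_distrib[of _ n])
  have ea: "a l $ k = (if l = j then u $ k else if k = l then 1 else 0)"
    if "l < n" "k < n" "k \<noteq> j" for k l
    using that u j by (auto simp: a_def)
  \<comment> \<open>For \<open>k \<noteq> j\<close> the product is
    \<open>a l $ k - u $ k * (w \<bullet> a l)\<close>. It vanishes for \<open>l = j\<close>, where
    both terms equal \<open>u $ k\<close>; otherwise \<open>w\<close> kills \<open>a l\<close>,
    whose coordinate \<open>k\<close> is that of \<open>unit_vec n l\<close>.\<close>
  have ba: "b k \<bullet> a l = (if k = l then 1 else 0)" if "k < n" "l < n" for k l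
    using that w a[of l] wa ea j by (auto simp: b_def minus_scalar_prod_distrib[of _ n])
  define \<tau> where "\<tau> = Transposition.transpose 0 j"
  have \<tau>: "\<tau> k < n" if "k < n" for k
    using that j by (auto simp: \<tau>_def Transposition.transpose_def)
  have \<tau>inj: "\<tau> k = \<tau> l \<longleftrightarrow> k = l" for k l
    unfolding \<tau>_def by (metis transpose_involutory)
  define A where "A = mat n n (\<lambda>(i, k). a (\<tau> k) $ i)"
  define B where "B = mat n n (\<lambda>(k, i). b (\<tau> k) $ i)"
  have AB: "A \<in> carrier_mat n n" "B \<in> carrier_mat n n"
    by (auto simp: A_def B_def)
  have colA: "col A k = a (\<tau> k)" if "k < n" for k
    using that a[of "\<tau> k"] by (intro eq_vecI) (auto simp: A_def)
  have rowB: "row B k = b (\<tau> k)" if "k < n" for k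
    using that b[of "\<tau> k"] by (intro eq_vecI) (auto simp: B_def)
  have "B * A = 1\<^sub>m n"
    using AB by (intro eq_matI) (auto simp: colA rowB ba \<tau> \<tau>inj)
  moreover have "A *\<^sub>v unit_vec n 0 = u" "B\<^sup>T *\<^sub>v unit_vec n 0 = w"
    using j u w by (auto intro!: eq_vecI simp: A_def B_def \<tau>_def a_def b_def)
  ultimately show ?thesis
    using AB by blast
qed

text \<open>Every vertex is the image of the base vertex
  \<open>(unit_vec n 0, unit_vec n 0)\<close>. The map \<open>A' * B\<close>, with inverse
  \<open>A * B'\<close>, goes back from \<open>x\<close> to the base vertex and then on to
  \<open>y\<close>.\<close>

lemma vertex_transitive_idempotent_graph:
  "vertex_transitive (idempotent_graph n :: ('k::field vec \<times> 'k vec) pair_pre_digraph)"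
    (is "vertex_transitive ?G")
  unfolding vertex_transitive_def
proof (intro ballI)
  fix x y assume xy: "x \<in> pverts ?G" "y \<in> pverts ?G"
  obtain u w u' w' where x: "x = (u, w)" and y: "y = (u', w')"
    by fastforce
  obtain A B where A: "A \<in> carrier_mat n n" and B: "B \<in> carrier_mat n n" and BA: "B * A = 1\<^sub>m n"
    and Au: "A *\<^sub>v unit_vec n 0 = u" and Bw: "B\<^sup>T *\<^sub>v unit_vec n 0 = w"
    using ex_dual_bases[of u n w] xy x by auto
  obtain A' B' where A': "A' \<in> carrier_mat n n" and B': "B' \<in> carrier_mat n n"
    and BA': "B' * A' = 1\<^sub>m n"
    and Au': "A' *\<^sub>v unit_vec n 0 = u'" and Bw': "B'\<^sup>T *\<^sub>v unit_vec n 0 = w'"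
    using ex_dual_bases[of u' n w'] xy y by auto
  let ?e = "unit_vec n 0 :: 'k vec"
  have AB: "A * B = 1\<^sub>m n"
    using mat_mult_left_right_inverse[OF B A BA] .
  have "(A * B') * (A' * B) = A * ((B' * A') * B)"
    using A B A' B' by (simp add: assoc_mult_mat[of _ n n _ n _ n])
  then have "(A * B') * (A' * B) = 1\<^sub>m n"
    using B by (simp add: BA' AB)
  then have "automorphism ?G (\<lambda>(u, w). ((A' * B) *\<^sub>v u, (A * B')\<^sup>T *\<^sub>v w))"
    using A B A' B' by (intro automorphism_idempotent_graph) auto
  moreover have "(A' * B) *\<^sub>v u = u'"
  proof -
    have "(A' * B) *\<^sub>v u = A' *\<^sub>v ((B * A) *\<^sub>v ?e)"
      using A B A' by (simp add: Au[symmetric] assoc_mult_mat_vec[of _ n n _ n])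
    then show ?thesis
      by (simp add: BA Au')
  qed
  moreover have "(A * B')\<^sup>T *\<^sub>v w = w'"
  proof -
    \<comment> \<open>Transposition reverses the product, so \<open>A\<^sup>T\<close> first returns
      \<open>w\<close> to the base covector and \<open>B'\<^sup>T\<close> then sends that to
      \<open>w'\<close>.\<close>
    have "(A * B')\<^sup>T *\<^sub>v w = B'\<^sup>T *\<^sub>v ((A\<^sup>T * B\<^sup>T) *\<^sub>v ?e)"
      using A B B' by (simp add: Bw[symmetric] transpose_mult[of _ n n _ n]
          assoc_mult_mat_vec[of _ n n _ n])
    also have "A\<^sup>T * B\<^sup>T = 1\<^sub>m n"
      using transpose_mult[OF B A] BA by simp
    finally show ?thesis
      by (simp add: Bw')
  qed
  ultimately show "\<exists>h. automorphism ?G h \<and> h x = y"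
    using x y by (intro exI[of _ "\<lambda>(u, w). ((A' * B) *\<^sub>v u, (A * B')\<^sup>T *\<^sub>v w)"]) simp
qed

section \<open>The tautological span colouring\<close>

text \<open>Each idempotent is coloured by its image and its kernel. The vector \<open>u\<close>
  lies in the image but not in the kernel, and mutual annihilation gives the two inclusions on an
  edge.\<close>

lemma span_colouring_idempotent_graph:
  assumes "0 < n"
  shows "span_colouring (idempotent_graph n) n
    (\<lambda>(u, w). (range (\<lambda>a. a \<cdot>\<^sub>v u), {v :: 'k::{field,finite} vec. v \<in> carrier_vec n \<and> w \<bullet> v = 0}))"
    (is "span_colouring ?G n ?f")
proof -
  have line: "range (\<lambda>a. a \<cdot>\<^sub>v u) \<in> grassmannian 1 n"
    if u: "u \<in> carrier_vec n" "u \<noteq> 0\<^sub>v n" for u :: "'k vec"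
  proof (rule grassmannianI)
    show "0\<^sub>v n \<in> range (\<lambda>a. a \<cdot>\<^sub>v u)"
      using u by (intro image_eqI[of _ _ 0]) auto
    show "v + w \<in> range (\<lambda>a. a \<cdot>\<^sub>v u)"
      if "v \<in> range (\<lambda>a. a \<cdot>\<^sub>v u)" "w \<in> range (\<lambda>a. a \<cdot>\<^sub>v u)" for v w
      using that by (auto simp flip: add_smult_distrib_vec)
    show "b \<cdot>\<^sub>v v \<in> range (\<lambda>a. a \<cdot>\<^sub>v u)" if "v \<in> range (\<lambda>a. a \<cdot>\<^sub>v u)" for b v
      using that by (auto simp: smult_smult_assoc)
    obtain i where "i < n" "u $ i \<noteq> 0"
      using u by (metis carrier_vecD eq_vecI index_zero_vec)
    then have "a = b" if "a \<cdot>\<^sub>v u = b \<cdot>\<^sub>v u" for a b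
      using u(1) arg_cong[OF that, of "\<lambda>v. v $ i"] by simp
    then have "inj (\<lambda>a. a \<cdot>\<^sub>v u)"
      by (rule injI)
    then show "card (range (\<lambda>a. a \<cdot>\<^sub>v u)) = CARD('k) ^ 1"
      by (simp add: card_image)
  qed (use u in auto)
  have plane: "{v. v \<in> carrier_vec n \<and> w \<bullet> v = 0} \<in> hyperplanes n"
    if w: "w \<in> carrier_vec n" "w \<noteq> 0\<^sub>v n" for w :: "'k vec"
  proof -
    obtain d where d: "d + 1 = n"
      using \<open>0 < n\<close> by (metis Suc_eq_plus1 Suc_pred)
    have "{v. v \<in> carrier_vec n \<and> w \<bullet> v = 0} \<in> grassmannian d n"
    proof (rule grassmannianI)
      \<comment> \<open>The level-set count reads
        \<open>CARD('k) * card = CARD('k) ^ (d + 1)\<close>, and one factor cancels.\<close>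
      show "card {v. v \<in> carrier_vec n \<and> w \<bullet> v = 0} = CARD('k) ^ d"
        using card_scalar_prod_level[OF w, of 0] d by auto
    qed (use w in \<open>auto simp: scalar_prod_add_distrib[of _ n]\<close>)
    with d show ?thesis
      by (auto simp: hyperplanes_def)
  qed
  show ?thesis
    unfolding span_colouring_def
  proof (intro conjI ballI)
    fix x assume x: "x \<in> pverts ?G"
    obtain u w where uw: "x = (u, w)"
      by fastforce
    have uw_in: "u \<in> carrier_vec n" "w \<in> carrier_vec n" "w \<bullet> u = 1"
      using x uw by auto
    then have "u \<noteq> 0\<^sub>v n" "w \<noteq> 0\<^sub>v n"
      by auto
    with uw_in show "?f x \<in> grassmannian 1 n \<times> hyperplanes n"
      using line plane uw by auto
    have "u \<in> fst (?f x)"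
      using uw by (auto intro: image_eqI[of _ _ 1])
    moreover have "u \<notin> snd (?f x)"
      using uw uw_in by auto
    ultimately show "\<not> fst (?f x) \<subseteq> snd (?f x)"
      by blast
  next
    fix e assume e: "e \<in> parcs ?G"
    obtain u w u' w' where "e = ((u, w), (u', w'))"
      by (metis surj_pair)
    with e show "case e of (x, y) \<Rightarrow> fst (?f x) \<subseteq> snd (?f y) \<and> fst (?f y) \<subseteq> snd (?f x)"
      by auto
  qed
qed

section \<open>Excluding a proper colouring with a prime number of colours\<close>

lemma not_colourable_idempotent_graph:
  assumes p: "prime p" and less: "CARD('k::{field,finite}) < p"
  shows "\<not> proper_colouring (idempotent_graph p :: ('k vec \<times> 'k vec) pair_pre_digraph) p c"
proof
  let ?q = "CARD('k)"
  assume col: "proper_colouring (idempotent_graph p :: ('k vec \<times> 'k vec) pair_pre_digraph) p c"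
  have "?q > 1"
    using card_mono[of "UNIV :: 'k set" "{0, 1}"] by simp
  have "p dvd card (pverts (idempotent_graph p :: ('k vec \<times> 'k vec) pair_pre_digraph))"
    using vertex_transitive_colouring_dvd[OF finite_pverts_idempotent_graph
        vertex_transitive_idempotent_graph clique_unit_vecs card_unit_vec_pairs _ col]
      prime_gt_0_nat[OF p] by blast
  \<comment> \<open>The counting formula brings in one extra factor \<open>?q\<close>; it does no
    harm, as \<open>p\<close> does not divide \<open>?q\<close>.\<close>
  then have "p dvd (?q ^ p - 1) * ?q ^ p"
    by (metis card_pverts_idempotent_graph dvd_mult)
  moreover have ndvd: "\<not> p dvd ?q"
    using less \<open>?q > 1\<close> by (auto dest: dvd_imp_le)
  then have "\<not> p dvd ?q ^ p"
    using p prime_dvd_power by blast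
  ultimately have "p dvd ?q ^ p - 1"
    using p by (simp add: prime_dvd_mult_iff)
  then have "[?q ^ p = 1] (mod p)"
    using \<open>?q > 1\<close> by (subst cong_altdef_nat) auto
  \<comment> \<open>Fermat turns \<open>?q ^ p\<close> into \<open>?q\<close> modulo
    \<open>p\<close>, so \<open>?q\<close> would be congruent to 1, against
    \<open>1 < ?q < p\<close>.\<close>
  moreover have "[?q ^ (p - 1) = 1] (mod p)"
    using fermat_theorem[OF p ndvd] .
  then have "[?q * ?q ^ (p - 1) = ?q * 1] (mod p)"
    by (rule cong_scalar_left)
  then have "[?q ^ p = ?q] (mod p)"
    using prime_gt_0_nat[OF p] by (simp add: power_eq_if)
  ultimately have "[?q = 1] (mod p)"
    by (meson cong_sym cong_trans)
  then show False
    using less \<open>?q > 1\<close> by (auto simp: cong_def)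
qed

section \<open>Bounds on the two chromatic numbers and passage to natural-number vertices\<close>

lemma less_chromatic_number:
  assumes "\<And>c. \<not> proper_colouring G n c"
  shows "enat n < chromatic_number G"
proof -
  have "Suc n \<le> m" if "proper_colouring G m c" for m c
  proof (rule ccontr)
    assume "\<not> Suc n \<le> m"
    then have "proper_colouring G n c"
      using that by (fastforce simp: proper_colouring_def)
    with assms show False
      by blast
  qed
  then have "enat (Suc n) \<le> chromatic_number G"
    unfolding chromatic_number_def by (intro INF_greatest) auto
  then show ?thesis
    by (rule less_le_trans[rotated]) simp
qed

lemma span_chromatic_number_le:
  fixes f :: "'v \<Rightarrow> 'k::field vec set \<times> 'k vec set"
  assumes "span_colouring G n f"
  shows "span_chromatic_number TYPE('k) G \<le> enat n"
  unfolding span_chromatic_number_def using assms by (intro INF_lower) auto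

text \<open>The theorem asks for vertices of type \<open>nat\<close>; the finite graph of
  idempotents is carried there along an injection of its vertex set.\<close>

definition relabel :: "('v \<Rightarrow> 'w) \<Rightarrow> 'v pair_pre_digraph \<Rightarrow> 'w pair_pre_digraph" where
  "relabel h G = \<lparr>pverts = h ` pverts G, parcs = map_prod h h ` parcs G\<rparr>"

lemma pair_graph_relabel:
  assumes "pair_graph G" and inj: "inj_on h (pverts G)"
  shows "pair_graph (relabel h G)"
proof -
  interpret pair_graph G by fact
  have sym: "(y, x) \<in> parcs G" if "(x, y) \<in> parcs G" for x y
    using that pair_sym_arcs by (auto simp: symmetric_def sym_def)
  show ?thesis
  proof
    show "finite (pverts (relabel h G))" "finite (parcs (relabel h G))"
      using pair_finite_verts pair_finite_arcs by (simp_all add: relabel_def)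
    show "fst e \<in> pverts (relabel h G)" "snd e \<in> pverts (relabel h G)"
      if "e \<in> parcs (relabel h G)" for e
      using that arc_fst_in_verts arc_snd_in_verts by (force simp: relabel_def)+
    show "fst e \<noteq> snd e" if e: "e \<in> parcs (relabel h G)" for e
    proof -
      obtain x y where xy: "e = (h x, h y)" "(x, y) \<in> parcs G"
        using e by (auto simp: relabel_def)
      then have "x \<noteq> y" "x \<in> pverts G" "y \<in> pverts G"
        using pair_no_loops[of "(x, y)"] in_arcsD1 in_arcsD2 by auto
      with inj xy show ?thesis
        by (simp add: inj_on_eq_iff)
    qed
    show "symmetric (relabel h G)"
      unfolding symmetric_def with_proj_simps
    proof (rule symI)
      fix a b assume "(a, b) \<in> parcs (relabel h G)"
      then obtain x y where "a = h x" "b = h y" "(x, y) \<in> parcs G"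
        by (auto simp: relabel_def)
      with sym[of x y] show "(b, a) \<in> parcs (relabel h G)"
        by (auto simp: relabel_def intro: image_eqI[of _ _ "(y, x)"])
    qed
  qed
qed

lemma proper_colouring_of_relabel:
  assumes "proper_colouring (relabel h G) n c"
  shows "proper_colouring G n (c \<circ> h)"
  using assms by (force simp: proper_colouring_def relabel_def)

lemma span_colouring_relabel:
  assumes "pair_graph G" and inj: "inj_on h (pverts G)" and f: "span_colouring G n f"
  shows "span_colouring (relabel h G) n (f \<circ> inv_into (pverts G) h)"
proof -
  interpret pair_graph G by fact
  have "inv_into (pverts G) h (h x) = x" if "x \<in> pverts G" for x
    using inj that by simp
  then show ?thesis
    using f in_arcsD1 in_arcsD2 by (auto simp: span_colouring_def relabel_def) blast+
qed

theorem proposition1p3: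
  shows "\<exists>G :: nat pair_pre_digraph.
    pair_graph G \<and>
    span_chromatic_number TYPE('k::{field,finite}) G < chromatic_number G"
proof -
  obtain p where p: "prime p" "CARD('k) < p"
    using bigger_prime by blast
  let ?G = "idempotent_graph p :: ('k vec \<times> 'k vec) pair_pre_digraph"
  obtain h :: "'k vec \<times> 'k vec \<Rightarrow> nat" where h: "inj_on h (pverts ?G)"
    using finite_imp_inj_to_nat_seg[OF finite_pverts_idempotent_graph] by blast
  have "span_chromatic_number TYPE('k) (relabel h ?G) \<le> enat p"
    using span_colouring_relabel[OF pair_graph_idempotent_graph h
        span_colouring_idempotent_graph[OF prime_gt_0_nat[OF p(1)]]]
    by (rule span_chromatic_number_le)
  also have "\<dots> < chromatic_number (relabel h ?G)"
    using not_colourable_idempotent_graph[OF p] proper_colouring_of_relabel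
    by (intro less_chromatic_number) blast
  finally show ?thesis
    using pair_graph_relabel[OF pair_graph_idempotent_graph h] by blast
qed

end
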